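(* The set $\mathbb{T}$ equipped with the addition $\oplus$ and the multiplication $\odot$ is a (non-idempotent) commutative semiring, with zero element $-\infty$ and multiplicative unit the real number $0$; moreover $(\mathbb{R}^\nu,\oplus)$ is an additive semigroup, and $(\mathbb{R},\odot)$ and $(\mathbb{R}^\nu,\odot)$ are multiplicative semigroups.
   Context: Let $\mathbb{R}^\nu=\{a^\nu : a\in\mathbb{R}\}$ be a disjoint copy of $\mathbb{R}$, let $-\infty$ be a formal element, and put $\mathbb{T}=\mathbb{R}\cup\{-\infty\}\cup\mathbb{R}^\nu$ (disjoint union). Order $\prec$ on $\mathbb{T}$: $-\infty\prec x$ for all $x\ne-\infty$; for real $a<b$: $a\prec b$, $a\prec b^\nu$, $a^\nu\prec b$, $a^\nu\prec b^\nu$; and $a\prec a^\nu$ for all $a\in\mathbb{R}$. Addition $\oplus$: $-\infty\oplus x=x\oplus-\infty=x$ for all $x\in\mathbb{T}$; $x\oplus y=\max_\prec\{x,y\}$ if $x\neq y$; $a\oplus a=a^\nu\oplus a^\nu=a^\nu$ for $a\in\mathbb{R}$. Multiplication $\odot$: $-\infty\odot x=x\odot-\infty=-\infty$ for all $x\in\mathbb{T}$; $a\odot b=a+b$ for $a,b\in\mathbb{R}$; $a^\nu\odot b=a\odot b^\nu=a^\nu\odot b^\nu=(a+b)^\nu$ for $a,b\in\mathbb{R}$. A commutative semiring is a set with two commutative monoid structures, addition (with zero element) and multiplication (with unit), such that multiplication distributes over addition and the zero element is multiplicatively absorbing. Non-idempotent means that $x\oplus x=x$ does not hold for all $x$. 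*)

theory Defs
  imports Complex_Main "HOL-Algebra.Ring"
begin

text \<open>The set \<open>\<T>\<close>: \<open>Tangible a\<close> is the real number \<open>a\<close>, \<open>Ghost a\<close> is \<open>a\<^sup>\<nu>\<close> and
  \<open>NegInf\<close> is \<open>-\<infinity>\<close>.\<close>

datatype ext_trop = NegInf | Tangible real | Ghost real

inductive prec :: "ext_trop \<Rightarrow> ext_trop \<Rightarrow> bool" where
  "x \<noteq> NegInf \<Longrightarrow> prec NegInf x"
| "a < b \<Longrightarrow> prec (Tangible a) (Tangible b)"
| "a < b \<Longrightarrow> prec (Tangible a) (Ghost b)"
| "a < b \<Longrightarrow> prec (Ghost a) (Tangible b)"
| "a < b \<Longrightarrow> prec (Ghost a) (Ghost b)"
| "prec (Tangible a) (Ghost a)"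

instantiation ext_trop :: linorder
begin

definition less_ext_trop :: "ext_trop \<Rightarrow> ext_trop \<Rightarrow> bool" where
  "x < y \<longleftrightarrow> prec x y"

definition less_eq_ext_trop :: "ext_trop \<Rightarrow> ext_trop \<Rightarrow> bool" where
  "x \<le> y \<longleftrightarrow> prec x y \<or> x = y"

instance
proof
  fix x y z :: ext_trop
  show "(x < y) = (x \<le> y \<and> \<not> y \<le> x)"
    unfolding less_ext_trop_def less_eq_ext_trop_def
    by (cases x; cases y) (auto simp: prec.simps)
  show "x \<le> x"
    by (simp add: less_eq_ext_trop_def)
  show "x \<le> y \<Longrightarrow> y \<le> z \<Longrightarrow> x \<le> z"
    unfolding less_eq_ext_trop_def
    by (cases x; cases y; cases z) (auto simp: prec.simps)
  show "x \<le> y \<Longrightarrow> y \<le> x \<Longrightarrow> x = y"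
    unfolding less_eq_ext_trop_def
    by (cases x; cases y) (auto simp: prec.simps)
  show "x \<le> y \<or> y \<le> x"
    unfolding less_eq_ext_trop_def
    by (cases x; cases y) (auto simp: prec.simps)
qed

end

text \<open>Here \<open>max\<close> is the maximum for the linear order \<open>prec\<close>.\<close>

definition trop_add :: "ext_trop \<Rightarrow> ext_trop \<Rightarrow> ext_trop" where
  "trop_add x y =
    (if x = NegInf then y
     else if y = NegInf then x
     else if x \<noteq> y then max x y
     else (case x of NegInf \<Rightarrow> NegInf | Tangible a \<Rightarrow> Ghost a | Ghost a \<Rightarrow> Ghost a))"

fun trop_mult :: "ext_trop \<Rightarrow> ext_trop \<Rightarrow> ext_trop" where
  "trop_mult NegInf x = NegInf"
| "trop_mult x NegInf = NegInf"
| "trop_mult (Tangible a) (Tangible b) = Tangible (a + b)"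
| "trop_mult (Ghost a) (Tangible b) = Ghost (a + b)"
| "trop_mult (Tangible a) (Ghost b) = Ghost (a + b)"
| "trop_mult (Ghost a) (Ghost b) = Ghost (a + b)"

definition trop_semiring :: "ext_trop ring" where
  "trop_semiring =
    \<lparr>carrier = UNIV, mult = trop_mult, one = Tangible 0, zero = NegInf, add = trop_add\<rparr>"

text \<open>The library locale \<open>semigroup\<close> only covers operations on a whole type.\<close>

locale semigroup_on =
  fixes A :: "'a set" and f :: "'a \<Rightarrow> 'a \<Rightarrow> 'a"
  assumes closed: "x \<in> A \<Longrightarrow> y \<in> A \<Longrightarrow> f x y \<in> A"
    and assoc: "x \<in> A \<Longrightarrow> y \<in> A \<Longrightarrow> z \<in> A \<Longrightarrow> f (f x y) z = f x (f y z)"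

end

theory Submission
  imports Defs
begin

text \<open>An element of \<open>\<T>\<close> other than \<open>-\<infinity>\<close> has a value in \<open>\<real>\<close> and is either tangible or ghost.
  On values, \<open>\<oplus>\<close> is the maximum and \<open>\<odot>\<close> is the sum, so the semiring laws for values are those of
  the max-plus semiring. What remains is to follow the tangible/ghost distinction, and here both
  operations have a description that does not depend on bracketing or order: a sum is tangible
  exactly when its maximal value is attained by a single summand and that summand is tangible, and a
  product is tangible exactly when all its factors are. Distributivity holds because
  multiplication by an element of value \<open>c\<close> translates all values by \<open>c\<close>, which preserves and
  reflects where the maximum is attained, while a ghost factor makes both sides ghost.

  In the formalization the order disappears once \<open>\<oplus>\<close> is given by comparing real values
  (\<open>trop_add_simps\<close>); each law then splits into finitely many statements of linear
  arithmetic.\<close>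

text \<open>For equal values the sum is ghost whatever the summands are: either they coincide and the
  doubling rule applies, or they are \<open>a\<close> and \<open>a\<^sup>\<nu>\<close>, whose maximum is \<open>a\<^sup>\<nu>\<close>. This is why the two mixed
  cases need a single comparison, strict on the tangible side.\<close>

lemma trop_add_simps [simp]:
  "trop_add NegInf x = x"
  "trop_add x NegInf = x"
  "trop_add (Tangible a) (Tangible b) =
    (if a < b then Tangible b else if b < a then Tangible a else Ghost a)"
  "trop_add (Tangible a) (Ghost b) = (if b < a then Tangible a else Ghost b)"
  "trop_add (Ghost a) (Tangible b) = (if a < b then Tangible b else Ghost a)"
  "trop_add (Ghost a) (Ghost b) = Ghost (max a b)"
  by (auto simp: trop_add_def max_def less_eq_ext_trop_def prec.simps)

lemma trop_mult_NegInf_right [simp]: "trop_mult x NegInf = NegInf"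
  by (cases x) auto

lemma trop_add_commute: "trop_add x y = trop_add y x"
  by (cases x; cases y) auto

lemma trop_add_assoc: "trop_add (trop_add x y) z = trop_add x (trop_add y z)"
  by (cases x; cases y; cases z) (auto simp: max_def)

lemma trop_mult_commute: "trop_mult x y = trop_mult y x"
  by (cases x; cases y) auto

lemma trop_mult_assoc: "trop_mult (trop_mult x y) z = trop_mult x (trop_mult y z)"
  by (cases x; cases y; cases z) auto

lemma trop_mult_one_left: "trop_mult (Tangible 0) x = x"
  by (cases x) auto

lemma trop_mult_add_distrib_right:
  "trop_mult (trop_add x y) z = trop_add (trop_mult x z) (trop_mult y z)"
  by (cases x; cases y; cases z) (auto simp: max_def)

lemma trop_mult_add_distrib_left:
  "trop_mult z (trop_add x y) = trop_add (trop_mult z x) (trop_mult z y)"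
  by (simp add: trop_mult_add_distrib_right trop_mult_commute [of z])

lemma comm_monoid_trop_semiring: "comm_monoid trop_semiring"
  by (rule comm_monoidI)
    (auto simp: trop_semiring_def trop_mult_assoc trop_mult_one_left intro: trop_mult_commute)

lemma abelian_monoid_trop_semiring: "abelian_monoid trop_semiring"
  by (rule abelian_monoidI)
    (auto simp: trop_semiring_def trop_add_assoc intro: trop_add_commute)

lemma semiring_trop_semiring: "semiring trop_semiring"
proof -
  interpret abelian_monoid trop_semiring by (rule abelian_monoid_trop_semiring)
  interpret comm_monoid trop_semiring by (rule comm_monoid_trop_semiring)
  show ?thesis
    by unfold_locales
      (auto simp: trop_semiring_def trop_mult_add_distrib_right trop_mult_add_distrib_left)
qed

theorem theorem1p8:
  shows "semiring trop_semiring \<and> comm_monoid trop_semiring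
    \<and> \<zero>\<^bsub>trop_semiring\<^esub> = NegInf \<and> \<one>\<^bsub>trop_semiring\<^esub> = Tangible 0
    \<and> \<not> (\<forall>x. trop_add x x = x)
    \<and> semigroup_on (range Ghost) trop_add
    \<and> semigroup_on (range Tangible) trop_mult
    \<and> semigroup_on (range Ghost) trop_mult"
proof (intro conjI)
  show "semiring trop_semiring" by (rule semiring_trop_semiring)
  show "comm_monoid trop_semiring" by (rule comm_monoid_trop_semiring)
  show "\<zero>\<^bsub>trop_semiring\<^esub> = NegInf" "\<one>\<^bsub>trop_semiring\<^esub> = Tangible 0"
    by (simp_all add: trop_semiring_def)
  have "trop_add (Tangible 0) (Tangible 0) \<noteq> Tangible 0" by simp
  then show "\<not> (\<forall>x. trop_add x x = x)" by blast
  show "semigroup_on (range Ghost) trop_add"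
    by unfold_locales (auto simp: trop_add_assoc)
  show "semigroup_on (range Tangible) trop_mult" "semigroup_on (range Ghost) trop_mult"
    by (unfold_locales; auto simp: trop_mult_assoc)+
qed

end
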